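(* Let $n \ge 2$, and let $r \ge 2$ and $s$ be integers with $\gcd(r,s)=1$. Then the cyclic system of $n$ simultaneous congruences $$ r\left(\frac{\prod_{k=1}^n q_k}{q_i}\right) \equiv s \pmod{|q_i|}, \qquad 1 \le i \le n, $$ has only finitely many integer solutions $(q_1, \dots, q_n) \in (\mathbb{Z}\setminus\{0\})^n$ with $\gcd(q_1 q_2 \cdots q_n, s) = 1$. All such solutions satisfy $$ \max_i\{q_i\} \le \left(r(n+1)\right)^{2^{n-1}} + |s|. $$ *)

theory Defs
  imports "HOL-Number_Theory.Cong" "HOL-Library.FuncSet"
begin

text \<open>
  A tuple of \<open>n\<close> nonzero integers is an extensional function on \<open>{1..n}\<close>, so that the set
  of solutions counts each tuple once. As each \<open>q i\<close> is nonzero and divides the product,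
  \<open>div\<close> is exact division.
\<close>

definition cyclic_system_solutions :: "nat \<Rightarrow> int \<Rightarrow> int \<Rightarrow> (nat \<Rightarrow> int) set" where
  "cyclic_system_solutions n r s =
     {q \<in> {1..n} \<rightarrow>\<^sub>E (UNIV - {0}).
        \<forall>i\<in>{1..n}. [r * ((\<Prod>k=1..n. q k) div q i) = s] (mod \<bar>q i\<bar>)}"

end

theory Submission
  imports Defs
begin

text \<open>
  Coprimality of \<open>\<Prod>q\<close> and \<open>s\<close> makes the \<open>q i\<close> pairwise coprime, so for every set \<open>B\<close> of
  indices \<open>\<Prod>\<^bsub>i\<in>B\<^esub> q i\<close> divides \<open>r (\<Sum>\<^bsub>i\<in>B\<^esub> P / q i) - s\<close>, where \<open>P\<close> is the full
  product. This number is nonzero because \<open>r\<close> does not divide \<open>s\<close>, and the resulting inequality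
  of absolute values is the engine of the proof. Suppose the largest \<open>\<bar>q M\<bar>\<close> exceeds \<open>\<bar>s\<bar>\<close>. With
  \<open>B\<close> the complement of the set of the \<open>k\<close> smallest terms, whose product is \<open>Q\<close>, the inequality
  bounds the next smallest term by \<open>r (n + 1) \<bar>Q\<bar>\<close>. Hence the product of the \<open>k\<close> smallest terms
  is at most \<open>(r (n + 1)) ^ (2 ^ k - 1)\<close> for \<open>k < n\<close>, and \<open>B = {M}\<close> then bounds \<open>\<bar>q M\<bar>\<close>.
\<close>

text \<open>The quotient of the full product by \<open>q i\<close> is written
  \<open>prod q (I - {i})\<close>, which removes the division.\<close>

locale cyclic_solution =
  fixes I :: "'a set" and q :: "'a \<Rightarrow> int" and r s :: int
  assumes finite_I: "finite I"
    and nonzero: "i \<in> I \<Longrightarrow> q i \<noteq> 0"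
    and r_ge_2: "r \<ge> 2"
    and coprime_r_s: "coprime r s"
    and coprime_prod_s: "coprime (prod q I) s"
    and dvd_diff: "i \<in> I \<Longrightarrow> q i dvd r * prod q (I - {i}) - s"
begin

lemma not_r_dvd_s: "\<not> r dvd s"
proof
  assume "r dvd s"
  then have "is_unit r" using coprime_r_s by (meson coprime_common_divisor dvd_refl)
  then show False using r_ge_2 by simp
qed

lemma coprime_q_s:
  assumes "i \<in> I"
  shows "coprime (q i) s"
  using coprime_prod_s assms finite_I by (meson coprime_divisors dvd_prodI dvd_refl)

text \<open>A common divisor of \<open>q i\<close> and \<open>q j\<close> divides
  \<open>prod q (I - {i})\<close>, which has \<open>q j\<close> as a factor. By the congruence for
  \<open>i\<close> it then divides \<open>s\<close>, which is coprime to \<open>q i\<close>.\<close>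

lemma coprime_q_q:
  assumes "i \<in> I" "j \<in> I" "i \<noteq> j"
  shows "coprime (q i) (q j)"
proof (rule coprimeI)
  fix d assume d: "d dvd q i" "d dvd q j"
  have "q j dvd prod q (I - {i})"
    using assms finite_I by (intro dvd_prodI) auto
  then have "d dvd r * prod q (I - {i})"
    using d by (meson dvd_trans dvd_mult)
  moreover have "d dvd r * prod q (I - {i}) - s"
    using d dvd_diff[OF assms(1)] by (meson dvd_trans)
  ultimately have "d dvd s"
    by (metis dvd_diff_commute dvd_add_right_iff diff_add_cancel)
  then show "is_unit d"
    using d coprime_q_s[OF assms(1)] by (meson coprime_common_divisor)
qed

text \<open>Every summand with \<open>i \<noteq> j\<close> contains the factor \<open>q j\<close>,
  so modulo \<open>q j\<close> only the congruence for \<open>j\<close> remains.\<close>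

lemma q_dvd_sum:
  assumes "B \<subseteq> I" "j \<in> B"
  shows "q j dvd r * (\<Sum>i\<in>B. prod q (I - {i})) - s"
proof -
  have fB: "finite B" using assms finite_I by (meson finite_subset)
  have "q j dvd (\<Sum>i\<in>B - {j}. prod q (I - {i}))"
    using assms finite_I by (intro dvd_sum dvd_prodI) auto
  then have "q j dvd (r * prod q (I - {j}) - s) + r * (\<Sum>i\<in>B - {j}. prod q (I - {i}))"
    using assms by (intro dvd_add dvd_diff) auto
  also have "\<dots> = r * (\<Sum>i\<in>B. prod q (I - {i})) - s"
    using sum.remove[OF fB assms(2), of "\<lambda>i. prod q (I - {i})"] by (simp add: algebra_simps)
  finally show ?thesis .
qed

lemma abs_prod_le:
  assumes "B \<subseteq> I"
  shows "\<bar>prod q B\<bar> \<le> \<bar>r * (\<Sum>i\<in>B. prod q (I - {i})) - s\<bar>"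
proof -
  have "prod q B dvd r * (\<Sum>i\<in>B. prod q (I - {i})) - s"
    unfolding cong_iff_dvd_diff[symmetric]
  proof (intro cong_cong_prod_coprime ballI impI)
    fix i assume "i \<in> B"
    then show "[r * (\<Sum>i\<in>B. prod q (I - {i})) = s] (mod q i)"
      using q_dvd_sum[OF assms] by (simp add: cong_iff_dvd_diff)
  next
    fix i j assume "i \<in> B" "j \<in> B" "i \<noteq> j"
    then show "coprime (q i) (q j)"
      using assms coprime_q_q by blast
  qed
  moreover have "r * (\<Sum>i\<in>B. prod q (I - {i})) - s \<noteq> 0"
    using not_r_dvd_s by (metis dvd_triv_left eq_iff_diff_eq_0)
  ultimately show ?thesis
    by (simp add: dvd_imp_le_int)
qed

text \<open>Take \<open>abs_prod_le\<close> for \<open>B = I - A\<close> and multiply by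
  \<open>\<bar>q j\<bar>\<close>. By minimality of \<open>q j\<close> each summand becomes at most
  \<open>Q * R\<close>, and the term with \<open>s\<close> becomes at most \<open>R\<close>, since
  \<open>R\<close> has the two distinct factors \<open>q j\<close> and \<open>q M\<close>. Then
  cancel \<open>R\<close>.\<close>

lemma next_term_bound:
  assumes A: "A \<subseteq> I" and M: "M \<in> I - A" "\<bar>s\<bar> \<le> \<bar>q M\<bar>"
    and j: "j \<in> I - A" "j \<noteq> M" and min: "\<And>i. i \<in> I - A \<Longrightarrow> \<bar>q j\<bar> \<le> \<bar>q i\<bar>"
  shows "\<bar>q j\<bar> \<le> r * (int (card I) + 1) * \<bar>prod q A\<bar>"
proof -
  define B where "B = I - A"
  define R where "R = \<bar>prod q B\<bar>"
  define Q where "Q = \<bar>prod q A\<bar>"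
  have fB: "finite B" using finite_I by (simp add: B_def)
  have nz: "q i \<noteq> 0" if "i \<in> B" for i using nonzero that by (simp add: B_def)
  have Rpos: "R > 0" using nz fB by (simp add: R_def)
  have Qpos: "Q \<ge> 1"
    using A nonzero finite_subset[OF A finite_I] by (auto simp: Q_def int_one_le_iff_zero_less)
  have product_le: "\<bar>q j\<bar> * \<bar>prod q (I - {i})\<bar> \<le> Q * R" if i: "i \<in> B" for i
  proof -
    have "I - {i} = A \<union> (B - {i})" using A i by (auto simp: B_def)
    then have "prod q (I - {i}) = prod q A * prod q (B - {i})"
      using prod.union_disjoint[of A "B - {i}" q] fB finite_subset[OF A finite_I]
      by (auto simp: B_def)
    moreover have "R = \<bar>q i\<bar> * \<bar>prod q (B - {i})\<bar>"
      using prod.remove[OF fB i, of q] by (simp add: R_def abs_mult)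
    moreover have "\<bar>q j\<bar> \<le> \<bar>q i\<bar>" using min i by (simp add: B_def)
    ultimately show ?thesis
      by (simp add: Q_def abs_mult mult.left_commute mult_left_mono mult_right_mono)
  qed
  have "R = \<bar>q j\<bar> * (\<bar>q M\<bar> * \<bar>prod q (B - {j} - {M})\<bar>)"
    using prod.remove[OF fB, of j q] prod.remove[of "B - {j}" M q] fB j M
    by (simp add: R_def abs_mult B_def)
  moreover have "\<bar>prod q (B - {j} - {M})\<bar> \<ge> 1"
    using nz fB by (auto simp: int_one_le_iff_zero_less)
  then have "\<bar>s\<bar> * 1 \<le> \<bar>q M\<bar> * \<bar>prod q (B - {j} - {M})\<bar>"
    using M by (intro mult_mono) auto
  ultimately have s: "\<bar>q j\<bar> * \<bar>s\<bar> \<le> R"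
    by (simp add: mult_left_mono)
  have "R \<le> \<bar>r * (\<Sum>i\<in>B. prod q (I - {i}))\<bar> + \<bar>s\<bar>"
    using abs_prod_le[of B] abs_triangle_ineq4[of "r * (\<Sum>i\<in>B. prod q (I - {i}))" s]
    by (simp add: R_def B_def)
  also have "\<dots> \<le> r * (\<Sum>i\<in>B. \<bar>prod q (I - {i})\<bar>) + \<bar>s\<bar>"
    using r_ge_2 sum_abs[of "\<lambda>i. prod q (I - {i})" B] by (simp add: abs_mult)
  finally have "\<bar>q j\<bar> * R \<le> \<bar>q j\<bar> * (r * (\<Sum>i\<in>B. \<bar>prod q (I - {i})\<bar>) + \<bar>s\<bar>)"
    by (intro mult_left_mono) auto
  also have "\<dots> = r * (\<Sum>i\<in>B. \<bar>q j\<bar> * \<bar>prod q (I - {i})\<bar>) + \<bar>q j\<bar> * \<bar>s\<bar>"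
    by (simp add: algebra_simps sum_distrib_left)
  also have "\<dots> \<le> r * (\<Sum>i\<in>B. Q * R) + R"
    using product_le s r_ge_2 by (intro add_mono mult_left_mono sum_mono) auto
  also have "\<dots> = (r * (int (card B) * Q) + 1) * R"
    by (simp add: algebra_simps)
  finally have "\<bar>q j\<bar> \<le> r * (int (card B) * Q) + 1"
    using Rpos by simp
  \<comment> \<open>Absorbing the 1 into \<open>r * Q\<close> turns the factor \<open>card I\<close>
    into \<open>card I + 1\<close>.\<close>
  also have "\<dots> \<le> r * (int (card I) * Q) + r * Q"
  proof (intro add_mono mult_left_mono mult_right_mono)
    show "int (card B) \<le> int (card I)" using finite_I by (simp add: B_def card_mono)
    show "1 \<le> r * Q" using mult_mono[of 1 r 1 Q] r_ge_2 Qpos by simp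
  qed (use Qpos r_ge_2 in auto)
  finally show ?thesis by (simp add: Q_def algebra_simps)
qed

text \<open>Keeping \<open>M\<close> out of \<open>A\<close> leaves it available as the large term
  at every step. A new term is at most \<open>c\<close> times the old product, so the exponents
  satisfy e(k+1) = 2 e(k) + 1 with e(0) = 0.\<close>

lemma smallest_terms:
  assumes M: "M \<in> I" "\<bar>s\<bar> \<le> \<bar>q M\<bar>" and max: "\<And>i. i \<in> I \<Longrightarrow> \<bar>q i\<bar> \<le> \<bar>q M\<bar>"
  shows "k < card I \<Longrightarrow> \<exists>A \<subseteq> I - {M}. card A = k \<and>
           \<bar>prod q A\<bar> \<le> (r * (int (card I) + 1)) ^ (2 ^ k - 1)"
proof (induction k)
  case 0
  then show ?case by (intro exI[of _ "{}"]) auto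
next
  case (Suc k)
  define c where "c = r * (int (card I) + 1)"
  have c: "c \<ge> 0" using r_ge_2 by (simp add: c_def)
  obtain A where A: "A \<subseteq> I - {M}" "card A = k" and Q: "\<bar>prod q A\<bar> \<le> c ^ (2 ^ k - 1)"
    using Suc by (auto simp: c_def)
  have fA: "finite A" using A finite_I by (meson finite_Diff finite_subset)
  have "I - {M} - A \<noteq> {}"
  proof
    assume "I - {M} - A = {}"
    then have "I - {M} = A" using A by auto
    then show False using Suc.prems A M finite_I by auto
  qed
  then obtain j where j: "j \<in> I - {M} - A" "\<And>i. i \<in> I - {M} - A \<Longrightarrow> \<bar>q j\<bar> \<le> \<bar>q i\<bar>"
    using ex_is_arg_min_if_finite[of "I - {M} - A" "\<lambda>i. \<bar>q i\<bar>"] finite_I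
    by (auto simp: is_arg_min_linorder)
  \<comment> \<open>\<open>j\<close> is minimal over \<open>I - {M} - A\<close>; maximality of
    \<open>M\<close> extends this to \<open>I - A\<close>.\<close>
  have "\<bar>q j\<bar> \<le> c * \<bar>prod q A\<bar>"
    unfolding c_def using A M j max by (intro next_term_bound[where M = M]) blast+
  then have "\<bar>prod q (insert j A)\<bar> \<le> c * \<bar>prod q A\<bar> * \<bar>prod q A\<bar>"
    using j fA by (simp add: abs_mult mult_right_mono)
  also have "\<dots> \<le> c * c ^ (2 ^ k - 1) * c ^ (2 ^ k - 1)"
    using Q c by (intro mult_mono) auto
  also have "\<dots> = c ^ (1 + (2 ^ k - 1) + (2 ^ k - 1))"
    by (simp only: power_add power_one_right)
  also have "1 + (2 ^ k - 1) + (2 ^ k - 1) = (2 ^ Suc k - 1 :: nat)"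
    using one_le_power[of "2::nat" k] by simp
  finally show ?case
    using A j fA by (intro exI[of _ "insert j A"]) (auto simp: c_def)
qed

lemma abs_le:
  assumes "i \<in> I"
  shows "\<bar>q i\<bar> \<le> (r * (int (card I) + 1)) ^ (2 ^ (card I - 1)) + \<bar>s\<bar>"
proof -
  define c where "c = r * (int (card I) + 1)"
  have c: "c \<ge> r" "c \<ge> 0" using r_ge_2 by (simp_all add: c_def)
  obtain M where M: "M \<in> I" and max: "\<And>i. i \<in> I \<Longrightarrow> \<bar>q i\<bar> \<le> \<bar>q M\<bar>"
    using ex_is_arg_min_if_finite[of I "\<lambda>i. - \<bar>q i\<bar>"] finite_I assms
    by (auto simp: is_arg_min_linorder)
  have "\<bar>q M\<bar> \<le> c ^ (2 ^ (card I - 1)) + \<bar>s\<bar>"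
  proof (cases "\<bar>q M\<bar> \<le> \<bar>s\<bar>")
    case True
    then show ?thesis using c by (simp add: add_increasing)
  next
    case False
    have card: "card I - 1 < card I" using M finite_I by (metis card_gt_0_iff diff_less empty_iff zero_less_one)
    obtain A where A: "A \<subseteq> I - {M}" "card A = card I - 1"
      and Q: "\<bar>prod q A\<bar> \<le> c ^ (2 ^ (card I - 1) - 1)"
      using smallest_terms[OF M _ max card] False by (auto simp: c_def)
    \<comment> \<open>With all other terms in \<open>A\<close>, the congruence for \<open>M\<close>
      alone bounds \<open>q M\<close>; the factor \<open>r \<le> c\<close> raises the exponent by
      one to a full power of 2.\<close>
    have "A = I - {M}" using A M finite_I by (intro card_subset_eq) auto
    then have "\<bar>q M\<bar> \<le> \<bar>r * prod q A - s\<bar>"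
      using abs_prod_le[of "{M}"] M by simp
    also have "\<dots> \<le> r * \<bar>prod q A\<bar> + \<bar>s\<bar>"
      using abs_triangle_ineq4[of "r * prod q A" s] r_ge_2 by (simp add: abs_mult)
    also have "\<dots> \<le> c * c ^ (2 ^ (card I - 1) - 1) + \<bar>s\<bar>"
      using Q c by (intro add_right_mono mult_mono) auto
    also have "c * c ^ (2 ^ (card I - 1) - 1) = c ^ (2 ^ (card I - 1))"
      by (simp flip: power_Suc)
    finally show ?thesis .
  qed
  then show ?thesis using max[OF assms] by (simp add: c_def)
qed

end

text \<open>Bounding absolute values confines the solutions to a finite box.\<close>

lemma cyclic_system_solutions_abs_le:
  assumes "r \<ge> 2" "gcd r s = 1" "q \<in> cyclic_system_solutions n r s"
    "gcd (\<Prod>k=1..n. q k) s = 1" "i \<in> {1..n}"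
  shows "\<bar>q i\<bar> \<le> (r * (int n + 1)) ^ (2 ^ (n - 1)) + \<bar>s\<bar>"
proof -
  have q: "q j \<noteq> 0" "[r * (prod q {1..n} div q j) = s] (mod \<bar>q j\<bar>)" if "j \<in> {1..n}" for j
    using assms(3) that by (auto simp: cyclic_system_solutions_def)
  have "cyclic_solution {1..n} q r s"
  proof
    fix j assume j: "j \<in> {1..n}"
    have "prod q {1..n} div q j = prod q ({1..n} - {j})"
      using q(1)[OF j] prod.remove[OF _ j, of q] by simp
    then show "q j dvd r * prod q ({1..n} - {j}) - s"
      using q(2)[OF j] by (simp add: cong_iff_dvd_diff)
  qed (use assms q in \<open>auto simp: coprime_iff_gcd_eq_1\<close>)
  from cyclic_solution.abs_le[OF this assms(5)] show ?thesis by simp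
qed

theorem theorem1p3:
  fixes n :: nat and r s :: int
  assumes "n \<ge> 2" and "r \<ge> 2" and "gcd r s = 1"
  shows "finite {q \<in> cyclic_system_solutions n r s. gcd (\<Prod>k=1..n. q k) s = 1} \<and>
         (\<forall>q \<in> cyclic_system_solutions n r s. gcd (\<Prod>k=1..n. q k) s = 1 \<longrightarrow>
            Max (q ` {1..n}) \<le> (r * (int n + 1)) ^ (2 ^ (n - 1)) + \<bar>s\<bar>)"
proof (intro conjI ballI impI)
  let ?K = "(r * (int n + 1)) ^ (2 ^ (n - 1)) + \<bar>s\<bar>"
  note bound = cyclic_system_solutions_abs_le[OF assms(2,3)]
  have "{q \<in> cyclic_system_solutions n r s. gcd (\<Prod>k=1..n. q k) s = 1}
          \<subseteq> {1..n} \<rightarrow>\<^sub>E {- ?K..?K}"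
  proof
    fix q assume "q \<in> {q \<in> cyclic_system_solutions n r s. gcd (\<Prod>k=1..n. q k) s = 1}"
    then have q: "q \<in> cyclic_system_solutions n r s" "gcd (\<Prod>k=1..n. q k) s = 1" by auto
    have "q i \<in> {- ?K..?K}" if "i \<in> {1..n}" for i
      using bound[OF q that] unfolding atLeastAtMost_iff by linarith
    then show "q \<in> {1..n} \<rightarrow>\<^sub>E {- ?K..?K}"
      using q(1) by (auto simp: cyclic_system_solutions_def PiE_iff)
  qed
  then show "finite {q \<in> cyclic_system_solutions n r s. gcd (\<Prod>k=1..n. q k) s = 1}"
    by (rule finite_subset) (intro finite_PiE; simp)
  fix q assume q: "q \<in> cyclic_system_solutions n r s" "gcd (\<Prod>k=1..n. q k) s = 1"
  show "Max (q ` {1..n}) \<le> ?K"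
    using bound[OF q] assms(1) by (subst Max_le_iff) (auto intro: order_trans[OF abs_ge_self])
qed

end
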